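(* For every integer $n \geq 0$, \[ \sum_{v \in \{N,E\}^n} \#\{(v_1,v_2) \in \mathrm{Tam}(v)^2 : v_1 \leq_v v_2\} = \frac{2\,(3n+3)!}{(n+2)!\,(2n+3)!}, \] where the sum runs over all $2^n$ grid paths $v$ of size $n$.
   Context: A grid path is a finite walk on $\mathbb{Z}^2$ starting at $(0,0)$ made of north steps $N=(0,1)$ and east steps $E=(1,0)$; its size is its number of steps. For a grid path $v$, $\mathrm{Tam}(v)$ is the set of grid paths with the same endpoints as $v$ that stay weakly above $v$. For $v_1 \in \mathrm{Tam}(v)$ and a lattice point $p$ on $v_1$, the horizontal distance $\mathrm{horiz}_v(p)$ is the maximum number of east steps one can take starting from $p$ without crossing $v$. If in $v_1$ the point $p$ is preceded by an $E$ step and followed by an $N$ step, let $p'$ be the first lattice point of $v_1$ after $p$ with $\mathrm{horiz}_v(p')=\mathrm{horiz}_v(p)$, and let $v_1'$ be the path obtained from $v_1$ by exchanging the $E$ step just before $p$ with the subpath of $v_1$ from $p$ to $p'$; then $v_1' \in \mathrm{Tam}(v)$ and we declare $v_1 \prec_v v_1'$. The partial order $\leq_v$ on $\mathrm{Tam}(v)$ is the reflexive–transitive closure of $\prec_v$ (it makes $\mathrm{Tam}(v)$ a lattice). An interval of $\mathrm{Tam}(v)$ is a pair $(v_1,v_2)$ with $v_1 \leq_v v_2$. *)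

theory Defs
  imports Complex_Main
begin

datatype step = North | East

type_synonym grid_path = "step list"

text \<open>Grid paths start at the origin and take north and east steps only, so the lattice points
  they visit have natural-number coordinates \<open>(x, y)\<close>.\<close>

definition endpoint :: "grid_path \<Rightarrow> nat \<times> nat" where
  "endpoint w = (count_list w East, count_list w North)"

definition points :: "grid_path \<Rightarrow> (nat \<times> nat) set" where
  "points w = {endpoint (take i w) | i. i \<le> length w}"

definition weakly_above :: "grid_path \<Rightarrow> nat \<times> nat \<Rightarrow> bool" where
  "weakly_above v p \<longleftrightarrow> (\<exists>y. (fst p, y) \<in> points v \<and> y \<le> snd p)"

definition Tam :: "grid_path \<Rightarrow> grid_path set" where
  "Tam v = {w. endpoint w = endpoint v \<and> (\<forall>p \<in> points w. weakly_above v p)}"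

text \<open>No point to the right of the endpoint of \<open>v\<close> is weakly above \<open>v\<close>, so on the top row the
  horizontal distance is the distance to that endpoint.\<close>

definition horiz :: "grid_path \<Rightarrow> nat \<times> nat \<Rightarrow> nat" where
  "horiz v p = Max {k. \<forall>j \<le> k. weakly_above v (fst p + j, snd p)}"

text \<open>In \<open>tam_cover v w w'\<close> the point \<open>p\<close> is \<open>endpoint (a @ [East])\<close>, and \<open>b\<close> is the subpath of
  \<open>w\<close> from \<open>p\<close> to \<open>p'\<close>.\<close>

definition tam_cover :: "grid_path \<Rightarrow> grid_path \<Rightarrow> grid_path \<Rightarrow> bool" where
  "tam_cover v w w' \<longleftrightarrow> w \<in> Tam v \<and>
    (\<exists>a b c. w = a @ [East] @ b @ c \<and> b \<noteq> [] \<and> hd b = North \<and>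
      horiz v (endpoint (a @ [East] @ b)) = horiz v (endpoint (a @ [East])) \<and>
      (\<forall>j. 0 < j \<and> j < length b \<longrightarrow>
        horiz v (endpoint (a @ [East] @ take j b)) \<noteq> horiz v (endpoint (a @ [East]))) \<and>
      w' = a @ b @ [East] @ c)"

definition tam_le :: "grid_path \<Rightarrow> grid_path \<Rightarrow> grid_path \<Rightarrow> bool" where
  "tam_le v = (tam_cover v)\<^sup>*\<^sup>*"

end

theory Submission
  imports Defs "HOL-Computational_Algebra.Polynomial" "HOL-Computational_Algebra.Formal_Power_Series"
begin

text \<open>
  Write \<open>v = E\<^bsup>c\<^sub>0\<^esup> N E\<^bsup>c\<^sub>1\<^esup> \<dots> N E\<^bsup>c\<^sub>b\<^esup>\<close>. Along a path of \<open>Tam v\<close> the horizontal distance starts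
  at \<open>c\<^sub>0\<close>, increases by \<open>c\<^sub>j\<close> at the \<open>j\<close>-th north step and decreases by \<open>1\<close> at each east step. Hence
  the pairs \<open>(v, w)\<close> with \<open>w \<in> Tam v\<close> and \<open>v\<close> of size \<open>n\<close> are the integer words of length \<open>n + 1\<close>
  with letters \<open>\<ge> -1\<close>, nonnegative prefix sums and total sum \<open>0\<close>; cutting such a word at its last
  return to \<open>0\<close> identifies it with a binary tree with \<open>n + 1\<close> nodes. The covering relation becomes the
  rotation \<open>(a b) c \<rightarrow> a (b c)\<close> with \<open>b\<close> not a leaf.

  A tree \<open>u\<close> lies above \<open>(l r)\<close> iff \<open>u\<close> is \<open>p\<close> with \<open>(s r')\<close> grafted at its rightmost leaf, where
  \<open>r'\<close> lies above \<open>r\<close> and cutting the right spine of some tree above \<open>l\<close> yields \<open>p\<close> and \<open>s\<close>, with \<open>s\<close>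
  not a leaf unless \<open>l\<close> is one. If \<open>x\<close> marks the length of the right spine of the upper tree and \<open>t\<close>
  the number of nodes, the generating function \<open>F\<close> of the intervals satisfies \<open>(x - 1) (F - 1) = x t F (x - 1 + F - F(1))\<close>. This equation
  determines \<open>F\<close>, and it is solved by \<open>F = T + (x - T) W\<close>, where \<open>T = 1 + t T\<^sup>3\<close> and
  \<open>W = t T\<^sup>2 + x t T W (1 + W)\<close>. Since \<open>W(1) = T - 1\<close>, this gives \<open>F(1) = 3 T - T\<^sup>2 - 1\<close>.
\<close>

subsection \<open>Restricted rotations of binary trees\<close>

datatype tree = Leaf | Node tree tree

fun nodes :: "tree \<Rightarrow> nat" where
  "nodes Leaf = 0"
| "nodes (Node l r) = Suc (nodes l + nodes r)"

fun spine :: "tree \<Rightarrow> nat" where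
  "spine Leaf = 0"
| "spine (Node l r) = Suc (spine r)"

fun graft :: "tree \<Rightarrow> tree \<Rightarrow> tree" where
  "graft Leaf s = s"
| "graft (Node l r) s = Node l (graft r s)"

inductive rot :: "tree \<Rightarrow> tree \<Rightarrow> bool" where
  root: "b \<noteq> Leaf \<Longrightarrow> rot (Node (Node a b) c) (Node a (Node b c))"
| left: "rot l l' \<Longrightarrow> rot (Node l r) (Node l' r)"
| right: "rot r r' \<Longrightarrow> rot (Node l r) (Node l r')"

lemma rot_NodeE:
  assumes "rot (Node l r) u"
  obtains (root) a b where "l = Node a b" "b \<noteq> Leaf" "u = Node a (Node b r)"
    | (left) l' where "rot l l'" "u = Node l' r"
    | (right) r' where "rot r r'" "u = Node l r'"
  using assms by (cases rule: rot.cases) auto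

lemma spine_graft: "spine (graft p s) = spine p + spine s"
  by (induction p) auto

lemma nodes_graft: "nodes (graft p s) = nodes p + nodes s"
  by (induction p) auto

lemma graft_eq_Leaf_iff: "graft p s = Leaf \<longleftrightarrow> p = Leaf \<and> s = Leaf"
  by (cases p) auto

lemma nodes_eq_0_iff: "nodes t = 0 \<longleftrightarrow> t = Leaf"
  by (cases t) auto

lemma rot_nodes: "rot s t \<Longrightarrow> nodes t = nodes s"
  by (induction rule: rot.induct) auto

lemma rots_nodes: "rot\<^sup>*\<^sup>* s t \<Longrightarrow> nodes t = nodes s"
  by (induction rule: rtranclp_induct) (auto simp: rot_nodes)

lemma rots_left: "rot\<^sup>*\<^sup>* l l' \<Longrightarrow> rot\<^sup>*\<^sup>* (Node l r) (Node l' r)"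
  by (induction rule: rtranclp_induct) (auto intro: rtranclp.rtrancl_into_rtrancl rot.left)

lemma rots_right: "rot\<^sup>*\<^sup>* r r' \<Longrightarrow> rot\<^sup>*\<^sup>* (Node l r) (Node l r')"
  by (induction rule: rtranclp_induct) (auto intro: rtranclp.rtrancl_into_rtrancl rot.right)

text \<open>Each root rotation pushes the new node one step down the right spine of
  \<open>p\<close>; the side condition holds because \<open>graft q s\<close> is a leaf only if
  \<open>s\<close> is.\<close>

lemma rots_graft_unfold:
  assumes "s \<noteq> Leaf"
  shows "rot\<^sup>*\<^sup>* (Node (graft p s) r) (graft p (Node s r))"
proof (induction p)
  case (Node a q)
  have "rot (Node (Node a (graft q s)) r) (Node a (Node (graft q s) r))"
    using assms by (intro rot.root) (auto simp: graft_eq_Leaf_iff)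
  with rots_right[OF Node(2)] show ?case
    by (simp add: converse_rtranclp_into_rtranclp)
qed simp

text \<open>A rotation at the marked node moves the cut of the unchanged tree
  \<open>graft p s\<close> one step down its spine; a rotation on or left of the spine of
  \<open>p\<close> is also one of \<open>graft p s\<close>; the others act inside \<open>s\<close>
  or \<open>r\<close>.\<close>

lemma rot_graft_NodeD:
  assumes "rot (graft p (Node s r)) u"
  shows "\<exists>p' s' r'. u = graft p' (Node s' r') \<and> rot\<^sup>*\<^sup>* r r' \<and>
    rot\<^sup>*\<^sup>* (graft p s) (graft p' s') \<and> (s \<noteq> Leaf \<longrightarrow> s' \<noteq> Leaf)"
  using assms
proof (induction p arbitrary: u)
  case Leaf
  then have "rot (Node s r) u" by simp
  then show ?case
  proof (cases rule: rot_NodeE)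
    case (root a b)
    then show ?thesis
      by (intro exI[of _ "Node a Leaf"] exI[of _ b] exI[of _ r]) auto
  next
    case (left l')
    then have "s \<noteq> Leaf \<longrightarrow> l' \<noteq> Leaf"
      using rot_nodes[of s l'] by (metis nodes_eq_0_iff)
    with left show ?thesis
      by (intro exI[of _ Leaf] exI[of _ l'] exI[of _ r]) auto
  next
    case (right r')
    then show ?thesis
      by (intro exI[of _ Leaf] exI[of _ s] exI[of _ r']) auto
  qed
next
  case (Node a q)
  then have "rot (Node a (graft q (Node s r))) u" by simp
  then show ?case
  proof (cases rule: rot_NodeE)
    case (root a' b)
    then show ?thesis
      by (intro exI[of _ "Node a' (Node b q)"] exI[of _ s] exI[of _ r]) (auto intro: rot.root)
  next
    case (left a')
    then show ?thesis
      by (intro exI[of _ "Node a' q"] exI[of _ s] exI[of _ r]) (auto intro: rot.left)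
  next
    case (right u')
    from Node.IH(2)[OF right(1)] obtain p' s' r' where
      "u' = graft p' (Node s' r')" "rot\<^sup>*\<^sup>* r r'" "rot\<^sup>*\<^sup>* (graft q s) (graft p' s')"
      "s \<noteq> Leaf \<longrightarrow> s' \<noteq> Leaf" by blast
    with right show ?thesis
      by (intro exI[of _ "Node a p'"] exI[of _ s'] exI[of _ r']) (auto intro: rots_right)
  qed
qed

text \<open>Forward, the described trees contain the start, with \<open>p\<close> a leaf, and are
  closed under rotation. Backward, rotate inside both subtrees and then unfold the spine of
  \<open>p\<close>. The clause on \<open>s\<close> reflects \<open>b \<noteq> Leaf\<close> in
  \<open>rot\<close>.\<close>

lemma rots_Node_iff:
  "rot\<^sup>*\<^sup>* (Node l r) u \<longleftrightarrow> (\<exists>p s r'. u = graft p (Node s r') \<and> rot\<^sup>*\<^sup>* r r' \<and>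
     rot\<^sup>*\<^sup>* l (graft p s) \<and> (l \<noteq> Leaf \<longrightarrow> s \<noteq> Leaf))" (is "?L \<longleftrightarrow> ?R")
proof
  assume ?L
  then show ?R
  proof (induction rule: rtranclp_induct)
    case base
    then show ?case
      by (intro exI[of _ Leaf] exI[of _ l] exI[of _ r]) auto
  next
    case (step u u')
    then obtain p s r' where u: "u = graft p (Node s r')" "rot\<^sup>*\<^sup>* r r'"
      "rot\<^sup>*\<^sup>* l (graft p s)" "l \<noteq> Leaf \<longrightarrow> s \<noteq> Leaf" by blast
    with rot_graft_NodeD[of p s r' u'] step(2) obtain p' s' r'' where
      "u' = graft p' (Node s' r'')" "rot\<^sup>*\<^sup>* r' r''"
      "rot\<^sup>*\<^sup>* (graft p s) (graft p' s')" "s \<noteq> Leaf \<longrightarrow> s' \<noteq> Leaf" by blast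
    with u show ?case
      by (intro exI[of _ p'] exI[of _ s'] exI[of _ r'']) (auto intro: rtranclp_trans)
  qed
next
  assume ?R
  then obtain p s r' where u: "u = graft p (Node s r')" "rot\<^sup>*\<^sup>* r r'"
      "rot\<^sup>*\<^sup>* l (graft p s)" "l \<noteq> Leaf \<longrightarrow> s \<noteq> Leaf" by blast
  have *: "rot\<^sup>*\<^sup>* (Node (graft p s) r') (graft p (Node s r'))"
  \<comment> \<open>A leaf \<open>s\<close> forces \<open>l\<close> to be a leaf, and then
    \<open>p\<close> is one too.\<close>
  proof (cases "s = Leaf")
    case True
    then have "graft p s = Leaf"
      using u rots_nodes[OF u(3)] by (simp add: nodes_eq_0_iff)
    then show ?thesis by (simp add: graft_eq_Leaf_iff)
  qed (rule rots_graft_unfold)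
  have "rot\<^sup>*\<^sup>* (Node l r) (Node (graft p s) r')"
    using rots_left[OF u(3)] rots_right[OF u(2)] rtranclp_trans by metis
  with * u(1) show ?L by (metis rtranclp_trans)
qed

definition intervals :: "nat \<Rightarrow> (tree \<times> tree) set" where
  "intervals n = {(t, u). nodes t = n \<and> rot\<^sup>*\<^sup>* t u}"

subsection \<open>Trees as Lukasiewicz words\<close>

fun bump :: "int list \<Rightarrow> int list" where
  "bump [] = []"
| "bump (c # cs) = (c + 1) # cs"

fun luk :: "tree \<Rightarrow> int list" where
  "luk Leaf = []"
| "luk (Node l r) = luk l @ (if r = Leaf then [0] else bump (luk r) @ [-1])"

definition luk_words :: "int list set" where
  "luk_words = {L. (\<forall>c\<in>set L. c \<ge> -1) \<and> (\<forall>i. sum_list (take i L) \<ge> 0) \<and> sum_list L = 0}"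

lemma length_bump [simp]: "length (bump L) = length L"
  by (cases L) auto

lemma bump_eq_Nil_iff [simp]: "bump L = [] \<longleftrightarrow> L = []"
  by (cases L) auto

lemma bump_append: "L \<noteq> [] \<Longrightarrow> bump (L @ M) = bump L @ M"
  by (cases L) auto

lemma bump_inj: "bump L = bump M \<Longrightarrow> L = M"
  by (cases L; cases M) auto

lemma sum_take_bump: "L \<noteq> [] \<Longrightarrow> i > 0 \<Longrightarrow> sum_list (take i (bump L)) = sum_list (take i L) + 1"
  by (cases L; cases i) auto

lemma sum_bump: "L \<noteq> [] \<Longrightarrow> sum_list (bump L) = sum_list L + 1"
  by (cases L) auto

lemma length_luk: "length (luk t) = nodes t"
  by (induction t) auto

lemma luk_eq_Nil_iff [simp]: "luk t = [] \<longleftrightarrow> t = Leaf"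
  by (cases t) auto

lemma luk_words_append:
  assumes "L \<in> luk_words" "M \<in> luk_words"
  shows "L @ M \<in> luk_words"
  using assms by (auto simp: luk_words_def)

lemma luk_words_bump:
  assumes L: "L \<in> luk_words" "L \<noteq> []"
  shows "bump L @ [-1] \<in> luk_words"
proof -
  have pre: "sum_list (take i (bump L @ [-1])) \<ge> 0" for i
  proof (cases "i \<le> length L")
    case True
    then show ?thesis using L
      by (cases "i = 0") (auto simp: luk_words_def sum_take_bump)
  next
    case False
    then show ?thesis using L by (simp add: luk_words_def sum_bump take_Cons')
  qed
  have "\<forall>c\<in>set (bump L @ [-1]). c \<ge> -1"
    using L by (cases L) (auto simp: luk_words_def)
  with pre show ?thesis using L by (simp add: luk_words_def sum_bump)
qed

lemma luk_in_luk_words: "luk t \<in> luk_words"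
proof (induction t)
  case Leaf
  then show ?case by (simp add: luk_words_def)
next
  case (Node l r)
  have "[0] \<in> luk_words" by (auto simp: luk_words_def take_Cons')
  with Node show ?case
    using luk_words_append luk_words_bump by simp
qed

lemma sum_luk: "sum_list (luk t) = 0"
  using luk_in_luk_words by (simp add: luk_words_def)

lemma sum_take_luk: "sum_list (take i (luk t)) \<ge> 0"
  using luk_in_luk_words by (simp add: luk_words_def)

lemma sum_luk_prefix: "luk t = A @ B \<Longrightarrow> sum_list A \<ge> 0"
  using sum_take_luk[of "length A" t] by simp

lemma sum_bump_luk_prefix: "bump (luk t) = A @ B \<Longrightarrow> A \<noteq> [] \<Longrightarrow> sum_list A \<ge> 1"
  using sum_take_luk[of "length A" t] sum_take_bump[of "luk t" "length A"] by (cases "luk t = []") auto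

text \<open>The excursion that ends the word, that is, the word of \<open>r\<close> lifted by one
  level. Its prefix sums vanish only at its two ends, so the cut before it can be recovered.\<close>

definition last_block :: "tree \<Rightarrow> int list" where
  "last_block r = (if r = Leaf then [0] else bump (luk r) @ [-1])"

lemma luk_Node: "luk (Node l r) = luk l @ last_block r"
  by (simp add: last_block_def)

declare luk.simps(2) [simp del]

lemma last_block_sum: "sum_list (last_block r) = 0"
  by (simp add: last_block_def sum_bump sum_luk)

lemma last_block_nonempty [simp]: "last_block r \<noteq> []"
  by (simp add: last_block_def)

lemma last_block_hd: "hd (last_block r) \<ge> 0"
proof (cases "r = Leaf")
  case False
  then obtain c L where "luk r = c # L" by (cases "luk r") auto
  with sum_take_luk[of 1 r] False show ?thesis by (simp add: last_block_def)
qed (simp add: last_block_def)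

text \<open>A proper prefix misses the final -1, hence is a prefix of \<open>bump (luk r)\<close>,
  where nonempty prefix sums are lifted by 1. The block of a leaf has no such prefix.\<close>

lemma last_block_prefix:
  assumes "last_block r = A @ B" "A \<noteq> []" "B \<noteq> []"
  shows "sum_list A \<ge> 1"
proof (cases "r = Leaf")
  case False
  with assms obtain B' where "bump (luk r) = A @ B'"
    by (cases B rule: rev_cases) (auto simp: last_block_def)
  with assms show ?thesis by (auto intro: sum_bump_luk_prefix)
qed (use assms in \<open>auto simp: last_block_def Cons_eq_append_conv\<close>)

lemma last_block_inj: "last_block r = last_block r' \<Longrightarrow> luk r = luk r'"
  by (auto simp: last_block_def split: if_splits dest: bump_inj)

text \<open>If the two cuts differed, the overlap \<open>us\<close> would be a nonempty proper
  prefix of a last block with sum 0.\<close>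

lemma luk_inj: "luk t = luk t' \<Longrightarrow> t = t'"
proof (induction "nodes t" arbitrary: t t' rule: less_induct)
  case less
  show ?case
  proof (cases t)
    case Leaf
    with less.prems show ?thesis by (metis luk_eq_Nil_iff)
  next
    case (Node l r)
    with less.prems obtain l' r' where t': "t' = Node l' r'"
      by (metis luk_eq_Nil_iff nodes.cases)
    have eq: "luk l @ last_block r = luk l' @ last_block r'"
      using less.prems by (simp add: Node t' luk_Node)
    then have "luk l = luk l' \<and> last_block r = last_block r'"
    proof -
      from eq obtain us where us: "luk l = luk l' @ us \<and> us @ last_block r = last_block r' \<or>
          luk l @ us = luk l' \<and> last_block r = us @ last_block r'"
        unfolding append_eq_append_conv2 by blast
      have "us = []"
      proof (rule ccontr)
        assume ne: "us \<noteq> []"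
        have "sum_list us = 0"
          using us sum_luk[of l] sum_luk[of l'] by (metis add_0 sum_list_append)
        moreover have "sum_list us \<ge> 1"
          using us last_block_prefix[of r' us "last_block r"] last_block_prefix[of r us "last_block r'"] ne
          by (metis last_block_nonempty)
        ultimately show False by simp
      qed
      with us show ?thesis by simp
    qed
    then show ?thesis
      using less.hyps[of l l'] less.hyps[of r r'] last_block_inj[of r r'] by (auto simp: Node t')
  qed
qed

text \<open>The last letter is 0 or -1, as the sum before it is nonnegative and the total is 0. A 0
  stands for a right subtree that is a leaf; a -1 closes a lifted word.\<close>

lemma luk_surj: "L \<in> luk_words \<Longrightarrow> \<exists>t. luk t = L"
proof (induction "length L" arbitrary: L rule: less_induct)
  case less
  show ?case
  proof (cases L rule: rev_cases)
    case Nil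
    then show ?thesis by (intro exI[of _ Leaf]) simp
  next
    case (snoc M c)
    from less.prems have pre: "sum_list (take i L) \<ge> 0" for i by (simp add: luk_words_def)
    have entries: "\<forall>c\<in>set L. c \<ge> -1" and sumL: "sum_list L = 0"
      using less.prems by (auto simp: luk_words_def)
    have "sum_list M \<ge> 0" using pre[of "length M"] by (simp add: snoc)
    with entries sumL have "c = 0 \<or> c = -1" by (auto simp: snoc)
    then show ?thesis
    proof
      assume c: "c = 0"
      have "M \<in> luk_words"
      proof -
        have "sum_list (take i M) \<ge> 0" for i
          using pre[of "min i (length M)"] by (simp add: snoc min_def split: if_splits)
        then show ?thesis using entries sumL c by (simp add: luk_words_def snoc)
      qed
      with less.hyps[of M] obtain l where "luk l = M" by (auto simp: snoc)
      then show ?thesis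
        by (intro exI[of _ "Node l Leaf"]) (simp add: luk_Node last_block_def snoc c)
    next
      assume c: "c = -1"
      \<comment> \<open>The last zero of the prefix sums before the final letter; position 0
        guarantees one. Beyond it the sums are at least 1, so the rest of \<open>M\<close> is
        \<open>bump Q\<close> for a word \<open>Q\<close>.\<close>
      define i where "i = (GREATEST i. i \<le> length M \<and> sum_list (take i M) = 0)"
      have i: "i \<le> length M \<and> sum_list (take i M) = 0"
        unfolding i_def by (rule GreatestI_nat[of _ 0 "length M"]) auto
      have imax: "j \<le> i" if "j \<le> length M" "sum_list (take j M) = 0" for j
        unfolding i_def by (rule Greatest_le_nat[of _ _ "length M"]) (use that in auto)
      have preM: "sum_list (take j M) \<ge> 0" for j
        using pre[of "min j (length M)"] by (simp add: snoc min_def split: if_splits)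
      have sumM: "sum_list M = 1" using sumL by (simp add: snoc c)
      define A where "A = take i M"
      define R where "R = drop i M"
      have AR: "M = A @ R" by (simp add: A_def R_def)
      have R: "R \<noteq> []" using i sumM by (auto simp: R_def)
      have sumR: "sum_list R = 1" using sumM i AR by (metis A_def add_0 sum_list_append)
      have Rpos: "sum_list (take j R) \<ge> 1" if "j > 0" "j \<le> length R" for j
      proof -
        have "sum_list (take (i + j) M) = sum_list (take j R)"
          using i by (simp add: take_add R_def)
        moreover have "sum_list (take (i + j) M) \<noteq> 0"
        proof -
          have "i + j \<le> length M" using that i by (simp add: R_def)
          with imax[of "i + j"] that show ?thesis by fastforce
        qed
        ultimately show ?thesis using preM[of "i + j"] by linarith
      qed
      obtain b R' where R': "R = b # R'" using R by (cases R) auto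
      define Q where "Q = (b - 1) # R'"
      have bQ: "bump Q = R" by (simp add: Q_def R')
      have Q: "Q \<noteq> []" by (simp add: Q_def)
      have "Q \<in> luk_words"
      proof -
        have "sum_list (take j Q) \<ge> 0" for j
        proof (cases "j = 0")
          case False
          have "sum_list (take j Q) = sum_list (take (min j (length Q)) Q)"
            by (simp add: min_def)
          also have "\<dots> \<ge> 0"
            using Rpos[of "min j (length Q)"] sum_take_bump[of Q "min j (length Q)"] False Q
            by (auto simp: bQ R' Q_def)
          finally show ?thesis .
        qed simp
        moreover have "sum_list Q = 0" using sum_bump[OF Q] sumR bQ by simp
        moreover have "\<forall>c\<in>set Q. c \<ge> -1"
          using entries Rpos[of 1] by (auto simp: snoc AR R' Q_def)
        ultimately show ?thesis by (simp add: luk_words_def)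
      qed
      with less.hyps[of Q] obtain r where r: "luk r = Q"
        by (auto simp: snoc AR R' Q_def)
      have "A \<in> luk_words"
        using entries i preM by (auto simp: luk_words_def snoc A_def dest: in_set_takeD)
      with less.hyps[of A] obtain l where l: "luk l = A" by (auto simp: snoc AR)
      have "r \<noteq> Leaf" using r Q by auto
      then have "luk (Node l r) = L"
        by (simp add: luk_Node last_block_def l r bQ snoc AR c)
      then show ?thesis by blast
    qed
  qed
qed

text \<open>The counterpart of \<open>tam_cover\<close>: the -1 is the east step before p, and
  \<open>B\<close>, the shortest nonempty factor of sum 0 after it, is the subpath from p to p',
  since prefix sums are horizontal distances.\<close>

definition luk_cover :: "int list \<Rightarrow> int list \<Rightarrow> bool" where
  "luk_cover L L' \<longleftrightarrow> (\<exists>A B C. L = A @ [-1] @ B @ C \<and> L' = A @ B @ [-1] @ C \<and> B \<noteq> [] \<and> hd B \<ge> 0 \<and>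
     sum_list B = 0 \<and> (\<forall>j. 0 < j \<and> j < length B \<longrightarrow> sum_list (take j B) > 0))"

lemma luk_cover_append: "luk_cover L L' \<Longrightarrow> luk_cover (K @ L @ M) (K @ L' @ M)"
  unfolding luk_cover_def
  by (elim exE conjE, rule_tac x = "K @ A" in exI, rule_tac x = B in exI, rule_tac x = "C @ M" in exI) simp

lemma rot_not_Leaf: "rot t t' \<Longrightarrow> t \<noteq> Leaf \<and> t' \<noteq> Leaf"
  by (cases rule: rot.cases) auto

text \<open>A root rotation moves the -1 that closes the block of \<open>b\<close> past the block of
  \<open>c\<close>; this -1 exists because \<open>b\<close> is not a leaf.\<close>

lemma rot_imp_luk_cover: "rot t t' \<Longrightarrow> luk_cover (luk t) (luk t')"
proof (induction rule: rot.induct)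
  case (root b a c)
  have "0 < sum_list (take j (last_block c))" if "0 < j" "j < length (last_block c)" for j
    using last_block_prefix[of c "take j (last_block c)" "drop j (last_block c)"] that by force
  then show ?case
    unfolding luk_cover_def
    by (intro exI[of _ "luk a @ bump (luk b)"] exI[of _ "last_block c"] exI[of _ "[]"])
      (use root in \<open>auto simp: luk_Node last_block_hd last_block_sum bump_append last_block_def[of b]
        last_block_def[of "Node b c"]\<close>)
next
  case (left l l' r)
  then show ?case using luk_cover_append[of "luk l" "luk l'" "[]" "last_block r"]
    by (simp add: luk_Node)
next
  case (right r r' l)
  then obtain A B C where ABC: "luk r = A @ [-1] @ B @ C" "luk r' = A @ B @ [-1] @ C" "B \<noteq> []"
     "hd B \<ge> 0" "sum_list B = 0" "\<And>j. 0 < j \<and> j < length B \<Longrightarrow> sum_list (take j B) > 0"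
    by (auto simp: luk_cover_def)
  \<comment> \<open>No word begins with -1, so the letter changed by \<open>bump\<close> lies in
    \<open>A\<close>, outside the exchange.\<close>
  have "A \<noteq> []" using sum_luk_prefix[of r "A @ [-1]" "B @ C"] ABC(1) by auto
  with ABC have "luk_cover (bump (luk r)) (bump (luk r'))"
    unfolding luk_cover_def
    by (intro exI[of _ "bump A"] exI[of _ B] exI[of _ C]) (simp add: bump_append)
  from luk_cover_append[OF this, of "luk l" "[-1]"] show ?case
    using rot_not_Leaf[OF right(1)] by (simp add: luk_Node last_block_def)
qed

text \<open>If the exchanged -1 lies in the last block, it does not close it, and the exchange takes
  place in \<open>luk r\<close>. Otherwise it either ends \<open>luk l\<close>, which gives a root
  rotation, or the exchange stays inside \<open>luk l\<close>.\<close>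

lemma luk_cover_imp_rot: "luk_cover (luk t) L' \<Longrightarrow> \<exists>t'. rot t t' \<and> luk t' = L'"
proof (induction t arbitrary: L')
  case Leaf
  then show ?case by (auto simp: luk_cover_def)
next
  case (Node l r)
  then obtain A B C where L: "luk l @ last_block r = A @ [-1] @ B @ C" and L': "L' = A @ B @ [-1] @ C"
    and B: "B \<noteq> []" "hd B \<ge> 0" "sum_list B = 0"
    and Bpos: "\<And>j. 0 < j \<and> j < length B \<Longrightarrow> sum_list (take j B) > 0"
    by (auto simp: luk_cover_def luk_Node)
  have "(\<exists>A'. A = luk l @ A' \<and> last_block r = A' @ [-1] @ B @ C) \<or>
      (\<exists>D. luk l = A @ [-1] @ D \<and> D @ last_block r = B @ C)"
  proof -
    from L have "luk l @ last_block r = A @ (- 1 # B @ C)" by simp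
    then obtain us where "luk l = A @ us \<and> us @ last_block r = - 1 # B @ C \<or>
        luk l @ us = A \<and> last_block r = us @ - 1 # B @ C"
      unfolding append_eq_append_conv2 by blast
    then show ?thesis by (cases us) auto
  qed
  then show ?case
  proof (elim disjE exE conjE)
    fix A' assume A: "A = luk l @ A'" and r: "last_block r = A' @ [-1] @ B @ C"
    then have rL: "r \<noteq> Leaf" using B by (auto simp: last_block_def Cons_eq_append_conv)
    have "A' \<noteq> []" using last_block_hd[of r] r by auto
    \<comment> \<open>With \<open>C\<close> empty, \<open>A' @ [-1]\<close> would be a proper prefix
      of the block with sum 0.\<close>
    have "C \<noteq> []"
    proof
      assume "C = []"
      with last_block_prefix[of r "A' @ [-1]" B] r B last_block_sum[of r]
      show False by auto
    qed
    then obtain C' c where C: "C = C' @ [c]" by (cases C rule: rev_cases) auto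
    with r rL have bl: "bump (luk r) = A' @ [-1] @ B @ C'" and c: "c = -1"
      by (auto simp: last_block_def)
    then obtain a A'' where A'': "A' = a # A''" using \<open>A' \<noteq> []\<close> by (cases A') auto
    have lr: "luk r = ((a - 1) # A'') @ [-1] @ B @ C'"
      by (rule bump_inj) (simp add: bl A'')
    have "luk_cover (luk r) (((a - 1) # A'') @ B @ [-1] @ C')"
      unfolding luk_cover_def lr using B Bpos by blast
    from Node.IH(2)[OF this] obtain r' where r': "rot r r'" "luk r' = ((a - 1) # A'') @ B @ [-1] @ C'"
      by blast
    have "luk (Node l r') = L'"
      using rot_not_Leaf[OF r'(1)] by (simp add: luk_Node last_block_def r'(2) L' A A'' C c)
    with r'(1) show ?thesis by (blast intro: rot.right)
  next
    fix D assume l: "luk l = A @ [-1] @ D" and D: "D @ last_block r = B @ C"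
    show ?thesis
    proof (cases "D = []")
      case True
      \<comment> \<open>\<open>B\<close> is a nonempty prefix of the block with sum 0, hence the
        whole block.\<close>
      have "C = []"
        using last_block_prefix[of r B C] D True B by auto
      with D True have BX: "B = last_block r" by simp
      have "l \<noteq> Leaf" using l by auto
      then obtain a b where lab: "l = Node a b" by (cases l) auto
      have "last (luk l) = -1" using l True by simp
      then have b: "b \<noteq> Leaf" by (auto simp: lab luk_Node last_block_def)
      have "luk (Node a (Node b r)) = L'"
        using l b by (simp add: lab True luk_Node last_block_def[of b] last_block_def[of "Node b r"]
            bump_append L' BX \<open>C = []\<close>)
      with b show ?thesis unfolding lab by (blast intro: rot.root)
    next
      case False
      have "sum_list A - 1 \<ge> 0" using sum_luk_prefix[of l "A @ [-1]" D] l by simp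
      then have sD: "sum_list D \<le> 0" using sum_luk[of l] l by simp
      from D obtain us where "D = B @ us \<and> us @ last_block r = C \<or> D @ us = B \<and> last_block r = us @ C"
        by (auto simp: append_eq_append_conv2)
      \<comment> \<open>Otherwise \<open>D\<close> would be a nonempty proper prefix of
        \<open>B\<close> with nonpositive sum.\<close>
      moreover have "us = []" if "D @ us = B"
      proof (rule ccontr)
        assume "us \<noteq> []"
        with Bpos[of "length D"] that False sD show False by auto
      qed
      ultimately obtain us where us: "D = B @ us" "us @ last_block r = C" by auto
      have "luk_cover (luk l) (A @ B @ [-1] @ us)"
        unfolding luk_cover_def l us using B Bpos by blast
      from Node.IH(1)[OF this] obtain l' where "rot l l'" "luk l' = A @ B @ [-1] @ us" by blast
      moreover from this have "luk (Node l' r) = L'" by (simp add: luk_Node L' flip: us(2))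
      ultimately show ?thesis by (blast intro: rot.left)
    qed
  qed
qed

subsection \<open>Grid paths as Lukasiewicz words\<close>

text \<open>The largest abscissa that the path reaches at height at most \<open>y\<close>; above the
  top row it is that of the endpoint.\<close>

fun row :: "grid_path \<Rightarrow> nat \<Rightarrow> nat" where
  "row [] y = 0"
| "row (East # v) y = Suc (row v y)"
| "row (North # v) 0 = 0"
| "row (North # v) (Suc y) = row v y"

lemma points_Nil: "points [] = {(0, 0)}"
  by (auto simp: points_def endpoint_def)

lemma points_Cons: "points (s # v) = insert (0, 0)
    ((\<lambda>(x, y). if s = East then (Suc x, y) else (x, Suc y)) ` points v)"
proof -
  have "points (s # v) = (\<lambda>i. endpoint (take i (s # v))) ` {..Suc (length v)}"
    by (auto simp: points_def)
  also have "{..Suc (length v)} = insert 0 (Suc ` {..length v})"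
    by (rule atMost_Suc_eq_insert_0)
  also have "(\<lambda>i. endpoint (take i (s # v))) ` \<dots> = insert (0, 0)
      ((\<lambda>i. endpoint (s # take i v)) ` {..length v})"
    by (auto simp: endpoint_def image_image)
  also have "(\<lambda>i. endpoint (s # take i v)) ` {..length v} =
      (\<lambda>(x, y). if s = East then (Suc x, y) else (x, Suc y)) ` points v"
    by (cases s) (auto simp: points_def endpoint_def image_iff)
  finally show ?thesis .
qed

lemma weakly_above_iff: "weakly_above v (x, y) \<longleftrightarrow> x \<le> row v y"
proof (induction v y arbitrary: x rule: row.induct)
  case (1 y)
  then show ?case by (auto simp: weakly_above_def points_Nil)
next
  case (2 v y)
  have "weakly_above (East # v) (x, y) \<longleftrightarrow> x = 0 \<or> (\<exists>x'. x = Suc x' \<and> weakly_above v (x', y))"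
    by (force simp: weakly_above_def points_Cons)
  then show ?case by (cases x) (auto simp: 2)
next
  case (3 v)
  then show ?case by (auto simp: weakly_above_def points_Cons)
next
  case (4 v y)
  have "weakly_above v (0, y)" using 4[of 0] by simp
  moreover have "weakly_above (North # v) (x, Suc y) \<longleftrightarrow> x = 0 \<or> weakly_above v (x, y)"
    by (force simp: weakly_above_def points_Cons)
  ultimately show ?case by (auto simp: 4)
qed

lemma horiz_eq:
  assumes "x \<le> row v y"
  shows "horiz v (x, y) = row v y - x"
proof -
  have "{k. \<forall>j \<le> k. weakly_above v (fst (x, y) + j, snd (x, y))} = {..row v y - x}"
    using assms by (auto simp: weakly_above_iff)
  then show ?thesis by (simp add: horiz_def Max_eq_iff)
qed

section \<open>Words as pairs of a lower and an upper path\<close>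

definition step_of :: "int \<Rightarrow> step" where
  "step_of c = (if c < 0 then East else North)"

text \<open>A nonnegative letter is a north step of both paths, together with the east steps of the
  lower path in the row entered; a -1 is an east step of the upper path only.\<close>

definition block :: "int \<Rightarrow> step list" where
  "block c = (if c < 0 then [] else North # replicate (nat c) East)"

text \<open>The first letter of a word is the initial horizontal distance, so it stands for no step of the
  path.\<close>

definition upper :: "int list \<Rightarrow> grid_path" where
  "upper L = map step_of (tl L)"

definition lower :: "int list \<Rightarrow> grid_path" where
  "lower L = replicate (nat (hd L)) East @ concat (map block (tl L))"

lemma row_replicate: "row (replicate k East @ v) y = k + row v y"
  by (induction k) auto

lemma row_blocks_0: "row (concat (map block K)) 0 = 0"
  by (induction K) (auto simp: block_def)

text \<open>The row bound minus the current abscissa of the upper path is the prefix sum, which thus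
  measures the horizontal distance. The blocks of \<open>M\<close> only affect higher rows.\<close>

lemma row_blocks:
  assumes "\<forall>c\<in>set K. c \<ge> -1"
  shows "int (row (concat (map block (K @ M))) (count_list (map step_of K) North))
    = sum_list K + int (count_list (map step_of K) East)"
  using assms
proof (induction K)
  case Nil
  then show ?case using row_blocks_0[of M] by simp
next
  case (Cons c K)
  show ?case
  proof (cases "c < 0")
    case True
    with Cons.prems have "c = -1" by auto
    then show ?thesis using Cons by (simp add: block_def step_of_def)
  next
    case False
    then show ?thesis using Cons by (simp add: block_def step_of_def row_replicate)
  qed
qed

lemma row_lower:
  assumes "c \<ge> 0" "\<forall>c\<in>set K. c \<ge> -1"
  shows "int (row (lower (c # K @ M)) (count_list (map step_of K) North))
    = c + sum_list K + int (count_list (map step_of K) East)"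
  using row_blocks[OF assms(2), of M] assms(1) by (simp add: lower_def row_replicate)

lemma count_replicate_East:
  "count_list (replicate k East) North = 0" "count_list (replicate k East) East = k"
  by (induction k) auto

lemma count_blocks:
  assumes "\<forall>c\<in>set K. c \<ge> -1"
  shows "count_list (concat (map block K)) North = count_list (map step_of K) North"
    "int (count_list (concat (map block K)) East) = sum_list K + int (count_list (map step_of K) East)"
proof -
  have c: "c < 0 \<Longrightarrow> c \<ge> -1 \<Longrightarrow> c = -1" for c :: int by simp
  show "count_list (concat (map block K)) North = count_list (map step_of K) North"
    by (induction K) (auto simp: block_def step_of_def count_replicate_East)
  show "int (count_list (concat (map block K)) East) = sum_list K + int (count_list (map step_of K) East)"
    using assms by (induction K) (auto simp: block_def step_of_def count_replicate_East dest: c)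
qed

lemma endpoint_eq_iff:
  assumes "c \<ge> 0" "\<forall>c\<in>set K. c \<ge> -1"
  shows "endpoint (upper (c # K)) = endpoint (lower (c # K)) \<longleftrightarrow> sum_list (c # K) = 0"
proof -
  show ?thesis
    using count_blocks[OF assms(2)] assms(1)
    by (simp add: endpoint_def upper_def lower_def count_replicate_East) linarith
qed

lemma luk_words_hd: "c # K \<in> luk_words \<Longrightarrow> c \<ge> 0"
  by (auto simp: luk_words_def dest: spec[of _ "Suc 0"])

text \<open>By \<open>row_lower\<close>, the sum of the first \<open>Suc i\<close> letters is the
  signed distance to the lower path after \<open>i\<close> steps.\<close>

lemma upper_in_Tam_iff:
  assumes "c \<ge> 0" "\<forall>c\<in>set K. c \<ge> -1"
  shows "upper (c # K) \<in> Tam (lower (c # K)) \<longleftrightarrow> c # K \<in> luk_words"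
proof -
  have wa: "weakly_above (lower (c # K)) (endpoint (take i (upper (c # K)))) \<longleftrightarrow>
      sum_list (take (Suc i) (c # K)) \<ge> 0" for i
  proof -
    have "\<forall>c\<in>set (take i K). c \<ge> -1" using assms by (auto dest: in_set_takeD)
    from row_lower[OF assms(1) this, of "drop i K"] show ?thesis
      by (simp add: weakly_above_iff endpoint_def upper_def take_map) linarith
  qed
  have "(\<forall>p\<in>points (upper (c # K)). weakly_above (lower (c # K)) p) \<longleftrightarrow>
      (\<forall>i. sum_list (take i (c # K)) \<ge> 0)" (is "?l \<longleftrightarrow> ?r")
  proof
    assume l: ?l
    show ?r
    proof
      fix i
      show "sum_list (take i (c # K)) \<ge> 0"
      proof (cases i)
        case (Suc j)
        have "endpoint (take (min j (length K)) (upper (c # K))) \<in> points (upper (c # K))"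
          by (auto simp: points_def upper_def)
        with l wa have "sum_list (take (Suc (min j (length K))) (c # K)) \<ge> 0" by blast
        then show ?thesis by (simp add: Suc min_def split: if_splits)
      qed simp
    qed
  next
    assume r: ?r
    show ?l
    proof
      fix p assume "p \<in> points (upper (c # K))"
      then obtain i where "p = endpoint (take i (upper (c # K)))" by (auto simp: points_def)
      with r wa[of i] show "weakly_above (lower (c # K)) p" by blast
    qed
  qed
  with endpoint_eq_iff[OF assms] assms show ?thesis
    by (auto simp: Tam_def luk_words_def)
qed

text \<open>Cut \<open>v\<close> into an initial run and one nonnegative letter per north step.
  Reading \<open>w\<close>, each north step takes the next letter and each east step inserts a -1;
  the letters match because both paths have equally many north steps.\<close>

lemma lower_upper_ex:
  assumes "w \<in> Tam v"
  shows "\<exists>L\<in>luk_words. L \<noteq> [] \<and> lower L = v \<and> upper L = w"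
proof -
  have "\<exists>c cs. v = replicate c East @ concat (map block cs) \<and> (\<forall>c\<in>set cs. c \<ge> 0) \<and>
      length cs = count_list v North"
  proof (induction v)
    case (Cons s v)
    then obtain c cs where v: "v = replicate c East @ concat (map block cs)" "\<forall>c\<in>set cs. c \<ge> 0"
      "length cs = count_list v North" by blast
    show ?case
    proof (cases s)
      case North
      have "block (int c) = North # replicate c East" by (simp add: block_def)
      with v North show ?thesis
        by (intro exI[of _ 0] exI[of _ "int c # cs"]) auto
    next
      case East
      with v show ?thesis
        by (intro exI[of _ "Suc c"] exI[of _ cs]) auto
    qed
  qed auto
  then obtain c cs where v: "v = replicate c East @ concat (map block cs)" "\<forall>c\<in>set cs. c \<ge> 0"
      "length cs = count_list v North" by blast
  from assms have "count_list w North = length cs" by (simp add: Tam_def endpoint_def v(3))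
  then have "\<exists>K. map step_of K = w \<and> concat (map block K) = concat (map block cs) \<and> (\<forall>c\<in>set K. c \<ge> -1)"
    using v(2)
  proof (induction w arbitrary: cs)
    case (Cons s w)
    show ?case
    proof (cases s)
      case East
      with Cons obtain K where "map step_of K = w" "concat (map block K) = concat (map block cs)"
        "\<forall>c\<in>set K. c \<ge> -1" by fastforce
      with East show ?thesis by (intro exI[of _ "-1 # K"]) (auto simp: step_of_def block_def[of "-1"])
    next
      case North
      with Cons obtain b bs where cs: "cs = b # bs" by (cases cs) auto
      with North Cons obtain K where "map step_of K = w" "concat (map block K) = concat (map block bs)"
        "\<forall>c\<in>set K. c \<ge> -1" by fastforce
      with North cs Cons.prems show ?thesis by (intro exI[of _ "b # K"]) (auto simp: step_of_def)
    qed
  qed auto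
  then obtain K where K: "map step_of K = w" "concat (map block K) = concat (map block cs)"
    "\<forall>c\<in>set K. c \<ge> -1" by blast
  then have lu: "lower (int c # K) = v" "upper (int c # K) = w" by (simp_all add: lower_def upper_def v)
  with upper_in_Tam_iff[of "int c" K] assms K have "int c # K \<in> luk_words" by simp
  with lu show ?thesis by blast
qed

lemma upper_in_Tam: "L \<in> luk_words \<Longrightarrow> L \<noteq> [] \<Longrightarrow> upper L \<in> Tam (lower L)"
  using upper_in_Tam_iff[of "hd L" "tl L"] luk_words_hd[of "hd L" "tl L"]
  by (cases L) (auto simp: luk_words_def)

lemma length_eq_count: "length (w :: grid_path) = count_list w East + count_list w North"
proof (induction w)
  case (Cons s w)
  then show ?case by (cases s) auto
qed simp

lemma length_lower: "L \<in> luk_words \<Longrightarrow> L \<noteq> [] \<Longrightarrow> Suc (length (lower L)) = length L"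
  using upper_in_Tam[of L] length_eq_count[of "upper L"] length_eq_count[of "lower L"]
  by (cases L) (auto simp: Tam_def endpoint_def upper_def)

lemma eq_if_prefix_sums_eq:
  fixes L M :: "int list"
  assumes "length L = length M" "\<And>i. i \<le> length L \<Longrightarrow> sum_list (take i L) = sum_list (take i M)"
  shows "L = M"
proof (rule nth_equalityI)
  fix i assume i: "i < length L"
  then show "L ! i = M ! i"
    using assms(2)[of i] assms(2)[of "Suc i"] assms(1) by (simp add: take_Suc_conv_app_nth)
qed (rule assms)

text \<open>The upper path fixes the point after each step, and there the lower path determines the
  prefix sum by \<open>row_lower\<close>.\<close>

lemma lower_upper_inj:
  assumes L: "L \<in> luk_words" "L \<noteq> []" and M: "M \<in> luk_words" "M \<noteq> []"
    and eq: "lower L = lower M" "upper L = upper M"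
  shows "L = M"
proof (rule eq_if_prefix_sums_eq)
  obtain c K where cK: "L = c # K" using L by (cases L) auto
  obtain d J where dJ: "M = d # J" using M by (cases M) auto
  have map: "map step_of K = map step_of J" using eq by (simp add: upper_def cK dJ)
  then show "length L = length M" by (metis cK dJ length_Cons length_map)
  fix i
  show "sum_list (take i L) = sum_list (take i M)"
  proof (cases i)
    case (Suc j)
    have "c \<ge> 0" "d \<ge> 0" "\<forall>c\<in>set (take j K). c \<ge> -1" "\<forall>c\<in>set (take j J). c \<ge> -1"
      using L M luk_words_hd[of c K] luk_words_hd[of d J] by (auto simp: cK dJ luk_words_def dest: in_set_takeD)
    with row_lower[of c "take j K" "drop j K"] row_lower[of d "take j J" "drop j J"]
    have "c + sum_list (take j K) = d + sum_list (take j J)"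
      using eq(1) map by (simp add: cK dJ flip: take_map)
    then show ?thesis by (simp add: Suc cK dJ)
  qed simp
qed

section \<open>Covers of paths and covers of words\<close>

lemma horiz_lower:
  assumes "c # K @ M \<in> luk_words"
  shows "int (horiz (lower (c # K @ M)) (endpoint (map step_of K))) = c + sum_list K"
proof -
  have "c \<ge> 0" "\<forall>c\<in>set K. c \<ge> -1" using assms luk_words_hd[OF assms] by (auto simp: luk_words_def)
  note row = row_lower[OF this, of M]
  have "c + sum_list K \<ge> 0"
    using assms by (auto simp: luk_words_def dest: spec[of _ "Suc (length K)"])
  with row show ?thesis by (simp add: endpoint_def horiz_eq)
qed

lemma luk_cover_imp_tam_cover:
  assumes L: "L \<in> luk_words" and cov: "luk_cover L L'"
  shows "tam_cover (lower L) (upper L) (upper L') \<and> lower L' = lower L"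
proof -
  obtain A B C where ABC: "L = A @ [-1] @ B @ C" "L' = A @ B @ [-1] @ C" "B \<noteq> []"
     "hd B \<ge> 0" "sum_list B = 0" "\<And>j. 0 < j \<Longrightarrow> j < length B \<Longrightarrow> sum_list (take j B) > 0"
    using cov by (auto simp: luk_cover_def)
  \<comment> \<open>The first letter is nonnegative, so it is not the exchanged -1; it stands for no
    step and is split off.\<close>
  have "A \<noteq> []" using L luk_words_hd[of "-1" "B @ C"] ABC(1) by auto
  then obtain c K where A: "A = c # K" by (cases A) auto
  have h: "int (horiz (lower L) (endpoint (map step_of K @ [East] @ take j (map step_of B))))
      = c + sum_list K - 1 + sum_list (take j B)" for j
  proof -
    have "L = c # (K @ [-1] @ take j B) @ (drop j B @ C)" by (simp add: ABC A)
    with L horiz_lower[of c "K @ [-1] @ take j B" "drop j B @ C"] show ?thesis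
      by (simp add: step_of_def take_map)
  qed
  have "hd (map step_of B) = North" using ABC by (simp add: hd_map step_of_def)
  moreover have "horiz (lower L) (endpoint (map step_of K @ [East] @ map step_of B)) =
      horiz (lower L) (endpoint (map step_of K @ [East]))"
    using h[of "length B"] h[of 0] ABC by simp
  moreover have "horiz (lower L) (endpoint (map step_of K @ [East] @ take j (map step_of B))) \<noteq>
      horiz (lower L) (endpoint (map step_of K @ [East]))" if "0 < j" "j < length B" for j
    using h[of j] h[of 0] ABC(6)[OF that] by auto
  moreover have "upper L \<in> Tam (lower L)" using upper_in_Tam[OF L] ABC by simp
  moreover have "upper L = map step_of K @ [East] @ map step_of B @ map step_of C"
    "upper L' = map step_of K @ map step_of B @ [East] @ map step_of C"
    by (simp_all add: upper_def ABC A step_of_def)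
  ultimately have "tam_cover (lower L) (upper L) (upper L')"
    unfolding tam_cover_def using ABC(3)
    by (intro conjI exI[of _ "map step_of K"] exI[of _ "map step_of B"] exI[of _ "map step_of C"]) auto
  moreover have "lower L' = lower L" by (simp add: lower_def ABC A block_def[of "-1"])
  ultimately show ?thesis by blast
qed

text \<open>\<open>tam_cover\<close> only says that the distance at p does not recur inside
  \<open>b\<close>. As the first letter is nonnegative and no letter is below -1, the sums cannot
  jump over 0 and stay positive.\<close>

lemma tam_cover_imp_luk_cover:
  assumes L: "L \<in> luk_words" "L \<noteq> []" and cov: "tam_cover (lower L) (upper L) w"
  shows "\<exists>L'. luk_cover L L' \<and> upper L' = w"
proof -
  obtain c K where cK: "L = c # K" using L by (cases L) auto
  obtain a b d where abd: "upper L = a @ [East] @ b @ d" "b \<noteq> []" "hd b = North"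
    "horiz (lower L) (endpoint (a @ [East] @ b)) = horiz (lower L) (endpoint (a @ [East]))"
    "\<And>j. 0 < j \<Longrightarrow> j < length b \<Longrightarrow>
      horiz (lower L) (endpoint (a @ [East] @ take j b)) \<noteq> horiz (lower L) (endpoint (a @ [East]))"
    "w = a @ b @ [East] @ d"
    using cov by (auto simp: tam_cover_def)
  from abd(1) have "map step_of K = a @ East # b @ d" by (simp add: upper_def cK)
  then obtain A e B D where K: "K = A @ e # B @ D" "map step_of A = a" "step_of e = East"
    "map step_of B = b" "map step_of D = d"
    by (auto simp: map_eq_append_conv map_eq_Cons_conv Cons_eq_map_conv append_eq_map_conv)
  have entries: "\<forall>c\<in>set K. c \<ge> -1" using L by (simp add: cK luk_words_def)
  have e: "e = -1" using K entries by (auto simp: step_of_def split: if_splits)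
  have B: "B \<noteq> []" using abd(2) K by auto
  have hdB: "hd B \<ge> 0"
  proof -
    have "step_of (hd B) = North" using abd(3) K(4) B hd_map by metis
    then show ?thesis by (simp add: step_of_def split: if_splits)
  qed
  have h: "int (horiz (lower L) (endpoint (a @ [East] @ take j b)))
      = c + sum_list A - 1 + sum_list (take j B)" for j
  proof -
    have "L = c # (A @ [-1] @ take j B) @ (drop j B @ D)" by (simp add: cK K e)
    moreover have "take j b = map step_of (take j B)" using K(4) by (auto simp: take_map)
    ultimately show ?thesis
      using L horiz_lower[of c "A @ [-1] @ take j B" "drop j B @ D"] K(2)
      by (simp add: step_of_def)
  qed
  have lenb: "length b = length B" using K by auto
  have sumB: "sum_list B = 0" using h[of "length B"] h[of 0] abd(4) lenb by simp
  have "sum_list (take j B) > 0" if "0 < j" "j < length B" for j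
    using that
  proof (induction j)
    case (Suc j)
    have ne: "sum_list (take (Suc j) B) \<noteq> 0"
      using h[of "Suc j"] h[of 0] abd(5)[of "Suc j"] Suc.prems lenb by auto
    show ?case
    proof (cases "j = 0")
      case True
      with ne B hdB show ?thesis by (cases B) auto
    next
      case False
      have "B ! j \<ge> -1" using entries Suc.prems by (auto simp: K)
      moreover have "sum_list (take (Suc j) B) = sum_list (take j B) + B ! j"
        using Suc.prems by (simp add: take_Suc_conv_app_nth)
      moreover have "sum_list (take j B) > 0" using Suc False by simp
      ultimately show ?thesis using ne by linarith
    qed
  qed simp
  then have "luk_cover L ((c # A) @ B @ [-1] @ D)"
    unfolding luk_cover_def using B hdB sumB
    by (intro exI[of _ "c # A"] exI[of _ B] exI[of _ D]) (simp add: cK K e)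
  moreover have "upper ((c # A) @ B @ [-1] @ D) = w"
    using K by (simp add: upper_def abd step_of_def)
  ultimately show ?thesis by blast
qed

lemma rots_imp_tam_le:
  assumes "rot\<^sup>*\<^sup>* t u"
  shows "tam_le (lower (luk t)) (upper (luk t)) (upper (luk u)) \<and> lower (luk u) = lower (luk t)"
  using assms
proof (induction rule: rtranclp_induct)
  case (step u u')
  then show ?case
    using luk_cover_imp_tam_cover[OF luk_in_luk_words rot_imp_luk_cover[OF step(2)]]
    by (auto simp: tam_le_def intro: rtranclp.rtrancl_into_rtrancl)
qed (simp add: tam_le_def)

lemma tam_le_imp_rots:
  assumes "tam_le (lower (luk t)) (upper (luk t)) w" "t \<noteq> Leaf"
  shows "\<exists>u. rot\<^sup>*\<^sup>* t u \<and> upper (luk u) = w"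
  using assms(1) unfolding tam_le_def
proof (induction rule: rtranclp_induct)
  case (step w w')
  then obtain u where u: "rot\<^sup>*\<^sup>* t u" "upper (luk u) = w" by blast
  then have "lower (luk u) = lower (luk t)" using rots_imp_tam_le by blast
  moreover have "luk u \<noteq> []" using rots_nodes[OF u(1)] assms(2) by (metis luk_eq_Nil_iff nodes_eq_0_iff)
  ultimately obtain L' where "luk_cover (luk u) L'" "upper L' = w'"
    using tam_cover_imp_luk_cover[OF luk_in_luk_words, of u w'] step(2) u by auto
  with luk_cover_imp_rot[of u L'] u show ?case
    by (metis rtranclp.rtrancl_into_rtrancl)
qed blast

section \<open>The bijection between path intervals and tree intervals\<close>

lemma finite_Tam: "finite (Tam v)"
proof (rule finite_subset)
  show "Tam v \<subseteq> {w. set w \<subseteq> {North, East} \<and> length w = length v}"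
    using step.exhaust by (auto simp: Tam_def endpoint_def length_eq_count)
qed (simp add: finite_lists_length_eq)

text \<open>A triple \<open>(v, v1, v2)\<close> corresponds to two trees whose words share the lower
  path \<open>v\<close>. A word has one letter more than \<open>v\<close> has steps, hence
  \<open>Suc n\<close>.\<close>

lemma sum_card_tam_intervals:
  "(\<Sum>v \<in> {v :: grid_path. length v = n}.
      card {(v1, v2). v1 \<in> Tam v \<and> v2 \<in> Tam v \<and> tam_le v v1 v2}) = card (intervals (Suc n))"
proof -
  define I where "I v = {(v1, v2). v1 \<in> Tam v \<and> v2 \<in> Tam v \<and> tam_le v v1 v2}" for v
  define V where "V = {v :: grid_path. length v = n}"
  define g where "g = (\<lambda>(t, u). (lower (luk t), upper (luk t), upper (luk u)))"
  have finV: "finite V"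
  proof (rule finite_subset)
    show "V \<subseteq> {w. set w \<subseteq> {North, East} \<and> length w = n}"
      using step.exhaust by (auto simp: V_def)
  qed (simp add: finite_lists_length_eq)
  have finI: "finite (I v)" for v
    by (rule finite_subset[of _ "Tam v \<times> Tam v"]) (auto simp: I_def finite_Tam)
  have ne: "t \<noteq> Leaf \<and> u \<noteq> Leaf" if "(t, u) \<in> intervals (Suc n)" for t u
    using that rots_nodes[of t u] by (auto simp: intervals_def)
  have inj: "inj_on g (intervals (Suc n))"
  proof (rule inj_onI, clarify)
    fix t u t' u' assume tu: "(t, u) \<in> intervals (Suc n)" "(t', u') \<in> intervals (Suc n)"
      and eq: "g (t, u) = g (t', u')"
    have "lower (luk u) = lower (luk t)" "lower (luk u') = lower (luk t')"
      using tu rots_imp_tam_le by (auto simp: intervals_def)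
    with eq have "lower (luk t) = lower (luk t')" "upper (luk t) = upper (luk t')"
      "lower (luk u) = lower (luk u')" "upper (luk u) = upper (luk u')" by (simp_all add: g_def)
    then have "luk t = luk t'" "luk u = luk u'"
      using ne[OF tu(1)] ne[OF tu(2)] by (auto intro!: lower_upper_inj simp: luk_in_luk_words)
    then show "t = t' \<and> u = u'" using luk_inj by blast
  qed
  have img: "g ` intervals (Suc n) = Sigma V I"
  proof (intro equalityI subsetI)
    fix z assume "z \<in> g ` intervals (Suc n)"
    then obtain t u where tu: "(t, u) \<in> intervals (Suc n)" "z = g (t, u)" by auto
    then have "tam_le (lower (luk t)) (upper (luk t)) (upper (luk u))" "lower (luk u) = lower (luk t)"
      using rots_imp_tam_le by (auto simp: intervals_def)
    moreover have "upper (luk t) \<in> Tam (lower (luk t))" "upper (luk u) \<in> Tam (lower (luk u))"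
      using ne[OF tu(1)] by (auto intro!: upper_in_Tam simp: luk_in_luk_words)
    moreover have "length (lower (luk t)) = n"
      using length_lower[OF luk_in_luk_words, of t] ne[OF tu(1)] tu(1)
      by (simp add: intervals_def length_luk)
    ultimately show "z \<in> Sigma V I" by (simp add: tu(2) g_def V_def I_def)
  next
    fix z assume "z \<in> Sigma V I"
    then obtain v v1 v2 where z: "z = (v, v1, v2)" "length v = n" "v1 \<in> Tam v" "tam_le v v1 v2"
      by (auto simp: V_def I_def)
    from lower_upper_ex[OF z(3)] luk_surj obtain t where
      t: "luk t \<noteq> []" "lower (luk t) = v" "upper (luk t) = v1" by metis
    from tam_le_imp_rots[of t v2] t z(4) obtain u where u: "rot\<^sup>*\<^sup>* t u" "upper (luk u) = v2"
      by auto
    have "nodes t = Suc n"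
      using length_lower[OF luk_in_luk_words t(1)] t(2) z(2) by (simp add: length_luk)
    with u have "(t, u) \<in> intervals (Suc n)" by (simp add: intervals_def)
    moreover have "z = g (t, u)" using t u z by (simp add: g_def)
    ultimately show "z \<in> g ` intervals (Suc n)" by blast
  qed
  have "(\<Sum>v\<in>V. card (I v)) = card (Sigma V I)"
    using finV finI by (simp add: card_SigmaI)
  also have "\<dots> = card (intervals (Suc n))"
    using card_image[OF inj] by (simp add: img)
  finally show ?thesis by (simp add: V_def I_def)
qed

subsection \<open>The recursive structure of the intervals\<close>

text \<open>Intervals with a marked cut of the right spine of the upper tree, as they occur for the
  left subtree in \<open>rots_Node_iff\<close>.\<close>

definition split_intervals :: "nat \<Rightarrow> (tree \<times> tree \<times> tree) set" where
  "split_intervals n =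
     {(t, p, s). nodes t = n \<and> rot\<^sup>*\<^sup>* t (graft p s) \<and> (t \<noteq> Leaf \<longrightarrow> s \<noteq> Leaf)}"

definition interval_poly :: "nat \<Rightarrow> real poly" where
  "interval_poly n = (\<Sum>(t, u)\<in>intervals n. monom 1 (spine u))"

text \<open>Only \<open>p\<close> is weighed, because in \<open>graft p (Node s r')\<close> the tree
  \<open>s\<close> leaves the right spine.\<close>

definition split_poly :: "nat \<Rightarrow> real poly" where
  "split_poly n = (\<Sum>(t, p, s)\<in>split_intervals n. monom 1 (spine p))"

lemma finite_trees: "finite {t. nodes t \<le> n}"
proof (induction n)
  case 0
  then show ?case by (simp add: nodes_eq_0_iff)
next
  case (Suc n)
  have "{t. nodes t \<le> Suc n} \<subseteq>
      insert Leaf ((\<lambda>(l, r). Node l r) ` ({t. nodes t \<le> n} \<times> {t. nodes t \<le> n}))"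
  proof
    fix t assume "t \<in> {t. nodes t \<le> Suc n}"
    then show "t \<in> insert Leaf ((\<lambda>(l, r). Node l r) ` ({t. nodes t \<le> n} \<times> {t. nodes t \<le> n}))"
      by (cases t) auto
  qed
  then show ?case using Suc by (meson finite_SigmaI finite_imageI finite_insert finite_subset)
qed

lemma finite_intervals: "finite (intervals n)"
proof (rule finite_subset)
  show "intervals n \<subseteq> {t. nodes t \<le> n} \<times> {t. nodes t \<le> n}"
    by (auto simp: intervals_def rots_nodes)
qed (simp add: finite_trees)

lemma finite_split_intervals: "finite (split_intervals n)"
proof (rule finite_subset)
  show "split_intervals n \<subseteq> {t. nodes t \<le> n} \<times> {t. nodes t \<le> n} \<times> {t. nodes t \<le> n}"
    using rots_nodes by (fastforce simp: split_intervals_def nodes_graft)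
qed (simp add: finite_trees)

text \<open>The right subtrees along a right spine strictly decrease in size, so the size of
  \<open>r\<close> locates the marked node.\<close>

lemma graft_Node_inject:
  assumes "graft p (Node s r) = graft p' (Node s' r')" "nodes r = nodes r'"
  shows "p = p' \<and> s = s' \<and> r = r'"
  using assms
proof (induction p arbitrary: p')
  case Leaf
  then show ?case by (cases p') (auto simp: nodes_graft)
next
  case (Node a q)
  then show ?case by (cases p') (auto simp: nodes_graft)
qed

text \<open>\<open>rots_Node_iff\<close> as a bijection, with \<open>i\<close> the size of the left
  subtree. The spine of the upper tree has length \<open>spine p + 1 + spine r'\<close>; the 1 gives
  the factor \<open>monom 1 1\<close>.\<close>

lemma interval_poly_Suc:
  "interval_poly (Suc n) = (\<Sum>i\<le>n. monom 1 1 * split_poly i * interval_poly (n - i))"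
proof -
  define B where "B = (SIGMA i:{..n}. split_intervals i \<times> intervals (n - i))"
  define g where "g = (\<lambda>(i::nat, (l, p, s), (r, r')). (Node l r, graft p (Node s r')))"
  have inj: "inj_on g B"
  proof (rule inj_onI)
    fix x y assume "x \<in> B" "y \<in> B" and eq: "g x = g y"
    moreover obtain i l p s r r' where x: "x = (i, (l, p, s), (r, r'))" by (cases x) auto
    moreover obtain j k q t m m' where y: "y = (j, (k, q, t), (m, m'))" by (cases y) auto
    ultimately have n: "nodes l = i" "nodes k = j" "nodes r = nodes r'" "nodes m = nodes m'"
      by (auto simp: B_def split_intervals_def intervals_def rots_nodes)
    from eq x y have e: "l = k" "r = m" "graft p (Node s r') = graft q (Node t m')"
      by (auto simp: g_def)
    with n have "p = q \<and> s = t \<and> r' = m'" by (intro graft_Node_inject) auto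
    with n e x y show "x = y" by auto
  qed
  have img: "g ` B = intervals (Suc n)"
  proof (intro equalityI subsetI)
    fix z assume "z \<in> g ` B"
    then show "z \<in> intervals (Suc n)"
      by (fastforce simp: B_def g_def split_intervals_def intervals_def rots_Node_iff)
  next
    fix z assume z: "z \<in> intervals (Suc n)"
    then obtain t u where tu: "z = (t, u)" "nodes t = Suc n" "rot\<^sup>*\<^sup>* t u"
      by (auto simp: intervals_def)
    then obtain l r where t: "t = Node l r" by (cases t) auto
    with tu obtain p s r' where "u = graft p (Node s r')" "rot\<^sup>*\<^sup>* r r'"
      "rot\<^sup>*\<^sup>* l (graft p s)" "l \<noteq> Leaf \<longrightarrow> s \<noteq> Leaf" by (auto simp: rots_Node_iff)
    with tu t have "z = g (nodes l, (l, p, s), (r, r'))" "(nodes l, (l, p, s), (r, r')) \<in> B"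
      by (auto simp: g_def B_def split_intervals_def intervals_def)
    then show "z \<in> g ` B" by blast
  qed
  have "interval_poly (Suc n) = (\<Sum>z\<in>B. case g z of (t, u) \<Rightarrow> monom 1 (spine u))"
    by (simp add: interval_poly_def flip: img) (simp add: sum.reindex[OF inj])
  also have "\<dots> = (\<Sum>i\<le>n. \<Sum>z\<in>split_intervals i \<times> intervals (n - i).
      case g (i, z) of (t, u) \<Rightarrow> monom 1 (spine u))"
    unfolding B_def
    by (subst sum.Sigma) (auto simp: finite_intervals finite_split_intervals)
  also have "\<dots> = (\<Sum>i\<le>n. \<Sum>z\<in>split_intervals i \<times> intervals (n - i).
      monom 1 1 * ((case fst z of (t, p, s) \<Rightarrow> monom 1 (spine p)) *
        (case snd z of (t, u) \<Rightarrow> monom 1 (spine u))))"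
    by (intro sum.cong refl)
      (auto simp: g_def spine_graft mult_monom split: prod.splits)
  also have "\<dots> = (\<Sum>i\<le>n. monom 1 1 * split_poly i * interval_poly (n - i))"
    unfolding split_poly_def interval_poly_def mult.assoc sum_product sum.cartesian_product
    by (simp only: sum_distrib_left case_prod_unfold)
  finally show ?thesis .
qed

lemma graft_split_ex: "j \<le> spine u \<Longrightarrow> \<exists>p s. u = graft p s \<and> spine p = j"
proof (induction u arbitrary: j)
  case Leaf
  then show ?case by (intro exI[of _ Leaf] exI[of _ Leaf]) auto
next
  case (Node l r)
  show ?case
  proof (cases j)
    case 0
    then show ?thesis by (intro exI[of _ Leaf] exI[of _ "Node l r"]) auto
  next
    case (Suc i)
    with Node.prems obtain p s where "r = graft p s" "spine p = i"
      using Node.IH(2)[of i] by auto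
    with Suc show ?thesis by (intro exI[of _ "Node l p"] exI[of _ s]) auto
  qed
qed

lemma graft_split_unique:
  "graft p s = graft p' s' \<Longrightarrow> spine p = spine p' \<Longrightarrow> p = p' \<and> s = s'"
proof (induction p arbitrary: p')
  case Leaf
  then show ?case by (cases p') auto
next
  case (Node a q)
  then show ?case by (cases p') auto
qed

text \<open>A cut is determined by the length \<open>j\<close> of its upper spine. For
  \<open>n > 0\<close> the lower part is not a leaf, which excludes
  \<open>j = spine u\<close>.\<close>

lemma split_poly_eq:
  assumes "n > 0"
  shows "split_poly n = (\<Sum>(t, u)\<in>intervals n. \<Sum>j<spine u. monom 1 j)"
proof -
  define g where "g = (\<lambda>(t::tree, p, s). ((t, graft p s), spine p))"
  have "inj_on g (split_intervals n)"
    using graft_split_unique by (auto simp: g_def inj_on_def)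
  moreover have img: "g ` split_intervals n = (SIGMA z:intervals n. {..<spine (snd z)})"
  proof (intro equalityI subsetI)
    fix z assume "z \<in> g ` split_intervals n"
    then obtain t p s where z: "z = ((t, graft p s), spine p)" "nodes t = n"
      "rot\<^sup>*\<^sup>* t (graft p s)" "t \<noteq> Leaf \<longrightarrow> s \<noteq> Leaf"
      by (auto simp: g_def split_intervals_def)
    with assms have "spine s > 0" by (cases t; cases s) auto
    with z show "z \<in> (SIGMA z:intervals n. {..<spine (snd z)})"
      by (simp add: intervals_def spine_graft)
  next
    fix z assume "z \<in> (SIGMA z:intervals n. {..<spine (snd z)})"
    then obtain t u j where z: "z = ((t, u), j)" "nodes t = n" "rot\<^sup>*\<^sup>* t u" "j < spine u"
      by (auto simp: intervals_def)
    with graft_split_ex[of j u] obtain p s where "u = graft p s" "spine p = j" by auto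
    with z have "z = g (t, p, s)" "(t, p, s) \<in> split_intervals n"
      by (auto simp: g_def split_intervals_def spine_graft)
    then show "z \<in> g ` split_intervals n" by blast
  qed
  ultimately have "split_poly n =
      (\<Sum>z\<in>(SIGMA z:intervals n. {..<spine (snd z)}). monom 1 (snd z))"
    by (simp add: sum.reindex split_poly_def flip: img)
      (auto simp: g_def intro!: sum.cong)
  also have "\<dots> = (\<Sum>z\<in>intervals n. \<Sum>j<spine (snd z). monom 1 j)"
    by (subst sum.Sigma) (auto simp: finite_intervals case_prod_unfold)
  finally show ?thesis by (simp add: case_prod_unfold)
qed

lemma sum_const_poly: "(\<Sum>i\<in>A. [:c i:]) = [:\<Sum>i\<in>A. c i:]"
  by (induction A rule: infinite_finite_induct) auto

text \<open>Multiplication by x - 1 telescopes the geometric sums; the subtracted ones add up to the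
  value at x = 1.\<close>

lemma split_poly_diff:
  assumes "n > 0"
  shows "(monom 1 1 - 1) * split_poly n = interval_poly n - [:poly (interval_poly n) 1:]"
proof -
  have geo: "(monom 1 1 - 1 :: real poly) * (\<Sum>j<k. monom 1 j) = monom 1 k - [:1:]" for k
    using power_diff_1_eq[of "monom 1 1 :: real poly" k]
    by (simp add: monom_power one_pCons)
  have "(monom 1 1 - 1) * split_poly n =
      (\<Sum>z\<in>intervals n. (monom 1 1 - 1) * (\<Sum>j<spine (snd z). monom 1 j))"
    by (simp only: split_poly_eq[OF assms] case_prod_unfold sum_distrib_left[of _ _ "intervals n"])
  also have "\<dots> = interval_poly n - [:\<Sum>z\<in>intervals n. 1:]"
    by (simp only: geo sum_subtractf sum_const_poly interval_poly_def case_prod_unfold)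
  finally show ?thesis
    by (simp add: interval_poly_def poly_sum poly_monom case_prod_unfold)
qed

lemma intervals_0: "intervals 0 = {(Leaf, Leaf)}"
  using rots_nodes by (fastforce simp: intervals_def nodes_eq_0_iff)

lemma interval_poly_0: "interval_poly 0 = 1"
  by (simp add: interval_poly_def intervals_0)

lemma split_poly_0: "split_poly 0 = 1"
proof -
  have "split_intervals 0 = {(Leaf, Leaf, Leaf)}"
    using rots_nodes by (fastforce simp: split_intervals_def nodes_eq_0_iff nodes_graft)
  then show ?thesis by (simp add: split_poly_def)
qed

lemma card_intervals: "real (card (intervals n)) = poly (interval_poly n) 1"
  by (simp add: interval_poly_def poly_sum poly_monom case_prod_unfold)

subsection \<open>The functional equation\<close>

unbundle fps_syntax

text \<open>Coefficient \<open>n\<close> of the iterates is constant from iterate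
  \<open>Suc n\<close> on, so the stable values form a fixed point.\<close>

lemma fps_fixpoint_exists:
  fixes \<Phi> :: "'a::zero fps \<Rightarrow> 'a fps"
  assumes "\<And>f g n. (\<And>i. i < n \<Longrightarrow> f $ i = g $ i) \<Longrightarrow> \<Phi> f $ n = \<Phi> g $ n"
  shows "\<exists>f. f = \<Phi> f"
proof -
  define it where "it k = (\<Phi> ^^ k) 0" for k
  have stable: "it k $ n = it (Suc n) $ n" if "n < k" for k n
    using that
  proof (induction n arbitrary: k rule: less_induct)
    case (less n)
    then obtain m where k: "k = Suc m" by (cases k) auto
    have "it m $ i = it n $ i" if "i < n" for i
      using less.IH[OF that, of m] less.IH[OF that, of n] less.prems that k by simp
    then have "\<Phi> (it m) $ n = \<Phi> (it n) $ n" by (rule assms)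
    then show ?case by (simp add: it_def k)
  qed
  define f where "f = Abs_fps (\<lambda>n. it (Suc n) $ n)"
  have "f $ n = \<Phi> f $ n" for n
  proof -
    have "\<Phi> f $ n = \<Phi> (it n) $ n"
      by (rule assms) (metis f_def fps_nth_Abs_fps stable)
    then show ?thesis by (simp add: f_def it_def)
  qed
  then show ?thesis by (intro exI[of _ f] fps_ext)
qed

lemma fps_mult_nth_cong:
  fixes f g f' g' :: "'a::semiring_0 fps"
  assumes "\<And>i. i \<le> n \<Longrightarrow> f $ i = f' $ i" "\<And>i. i \<le> n \<Longrightarrow> g $ i = g' $ i"
  shows "(f * g) $ n = (f' * g') $ n"
  unfolding fps_mult_nth using assms by (intro sum.cong) auto

text \<open>Bivariate series are series in t, written \<open>fps_X\<close>, over polynomials in x,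
  written \<open>cvar\<close>. \<open>lift\<close> embeds the series free of x, and
  \<open>at1\<close> sets x = 1.\<close>

definition lift :: "real fps \<Rightarrow> real poly fps" where
  "lift f = Abs_fps (\<lambda>n. [:f $ n:])"

definition at1 :: "real poly fps \<Rightarrow> real fps" where
  "at1 f = Abs_fps (\<lambda>n. poly (f $ n) 1)"

lemma lift_nth: "lift f $ n = [:f $ n:]"
  by (simp add: lift_def)

lemma at1_nth: "at1 f $ n = poly (f $ n) 1"
  by (simp add: at1_def)

lemma lift_hom:
  "lift 1 = 1" "lift fps_X = fps_X" "lift (f + g) = lift f + lift g"
  "lift (f - g) = lift f - lift g" "lift (f * g) = lift f * lift g"
proof -
  show "lift (f * g) = lift f * lift g"
    by (rule fps_ext) (simp add: lift_nth fps_mult_nth sum_const_poly mult.commute)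
qed (auto intro!: fps_ext simp: lift_nth one_pCons fps_X_def)

lemma lift_power: "lift (f ^ k) = lift f ^ k"
  by (induction k) (simp_all add: lift_hom)

lemma at1_hom:
  "at1 1 = 1" "at1 fps_X = fps_X" "at1 (f + g) = at1 f + at1 g"
  "at1 (f - g) = at1 f - at1 g" "at1 (f * g) = at1 f * at1 g"
  by (auto intro!: fps_ext simp: at1_nth fps_mult_nth poly_sum fps_X_def)

lemma at1_power: "at1 (f ^ k) = at1 f ^ k"
  by (induction k) (simp_all add: at1_hom)

lemma at1_lift: "at1 (lift f) = f"
  by (rule fps_ext) (simp add: at1_nth lift_nth)

definition cvar :: "real poly fps" where
  "cvar = fps_const (monom 1 1)"

lemma at1_cvar: "at1 cvar = 1"
  by (rule fps_ext) (simp add: at1_nth cvar_def poly_monom)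

lemma cvar_minus_1_nonzero: "cvar - 1 \<noteq> 0"
proof
  assume "cvar - 1 = 0"
  then have "(cvar - 1) $ 0 = 0" by simp
  then have "coeff (monom 1 1 - 1 :: real poly) 1 = 0" by (simp add: cvar_def)
  then show False by simp
qed

section \<open>The catalytic equation: uniqueness and explicit solution\<close>

definition catalytic :: "real poly fps \<Rightarrow> bool" where
  "catalytic F \<longleftrightarrow> (cvar - 1) * (F - 1) = fps_X * (cvar * F * (cvar - 1 + F - lift (at1 F)))"

text \<open>The factor \<open>fps_X\<close> makes each coefficient on the right depend on lower
  coefficients only; on the left x - 1 cancels.\<close>

lemma catalytic_unique:
  assumes F: "catalytic F" and H: "catalytic H"
  shows "F = H"
proof (rule fps_ext)
  fix n show "F $ n = H $ n"
  proof (induction n rule: less_induct)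
    case (less n)
    define R where "R K = cvar * K * (cvar - 1 + K - lift (at1 K))" for K
    have "(fps_X * R F) $ n = (fps_X * R H) $ n"
    proof (cases n)
      case (Suc m)
      have eq: "F $ i = H $ i" if "i \<le> m" for i using less Suc that by simp
      have "R F $ m = R H $ m"
        unfolding R_def
        by (intro fps_mult_nth_cong) (auto simp: eq lift_nth at1_nth)
      then show ?thesis by (simp add: Suc)
    qed simp
    then have "((cvar - 1) * (F - H)) $ n = 0"
      using arg_cong[OF F[unfolded catalytic_def], of "\<lambda>f. f $ n"]
        arg_cong[OF H[unfolded catalytic_def], of "\<lambda>f. f $ n"]
      by (simp add: R_def algebra_simps)
    moreover have "cvar - 1 = fps_const (monom 1 1 - 1)"
      by (simp add: cvar_def flip: fps_const_sub)
    moreover have "monom 1 1 - 1 \<noteq> (0 :: real poly)"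
      using cvar_minus_1_nonzero by (auto simp: cvar_def)
    ultimately show ?case by simp
  qed
qed

lemma ternary_exists: "\<exists>T :: real fps. T = 1 + fps_X * T ^ 3"
proof (rule fps_fixpoint_exists)
  fix f g :: "real fps" and n :: nat
  assume eq: "\<And>i. i < n \<Longrightarrow> f $ i = g $ i"
  show "(1 + fps_X * f ^ 3) $ n = (1 + fps_X * g ^ 3) $ n"
  proof (cases n)
    case (Suc m)
    then have "(f * (f * f)) $ m = (g * (g * g)) $ m"
      by (intro fps_mult_nth_cong eq) auto
    with Suc show ?thesis by (simp add: power3_eq_cube mult.assoc)
  qed simp
qed

lemma catalytic_solution:
  fixes T :: "real fps"
  assumes T: "T = 1 + fps_X * T ^ 3"
  shows "\<exists>F. catalytic F \<and> at1 F = 3 * T - T ^ 2 - 1"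
proof -
  define S where "S = lift T"
  have S: "S = 1 + fps_X * S ^ 3"
    unfolding S_def by (subst T) (simp add: lift_hom lift_power)
  have "\<exists>W. W = fps_X * (S ^ 2 + cvar * S * W * (1 + W))"
  proof (rule fps_fixpoint_exists)
    fix f g :: "real poly fps" and n :: nat
    assume eq: "\<And>i. i < n \<Longrightarrow> f $ i = g $ i"
    show "(fps_X * (S ^ 2 + cvar * S * f * (1 + f))) $ n = (fps_X * (S ^ 2 + cvar * S * g * (1 + g))) $ n"
    proof (cases n)
      case (Suc m)
      then have "(cvar * S * f * (1 + f)) $ m = (cvar * S * g * (1 + g)) $ m"
        by (intro fps_mult_nth_cong) (auto simp: eq)
      with Suc show ?thesis by simp
    qed simp
  qed
  then obtain W where W: "W = fps_X * (S ^ 2 + cvar * S * W * (1 + W))" by blast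
  define V where "V = at1 W"
  have V: "V = fps_X * (T ^ 2 + T * V * (1 + V))"
    unfolding V_def by (subst W) (simp add: at1_hom at1_power at1_cvar S_def at1_lift)
  \<comment> \<open>At x = 1 the equation of \<open>W\<close> becomes quadratic in \<open>V\<close>,
    and \<open>T - 1\<close> also solves it. The cofactor of the difference has constant coefficient
    1.\<close>
  have "(V - (T - 1)) * (1 - fps_X * T * (V + T)) = 0"
    using V T by algebra
  moreover have "1 - fps_X * T * (V + T) \<noteq> 0"
  proof
    assume "1 - fps_X * T * (V + T) = 0"
    then have "(1 - fps_X * T * (V + T)) $ 0 = 0" by simp
    then show False by (simp add: fps_mult_nth_0)
  qed
  ultimately have V1: "V = T - 1" by simp
  define F where "F = S + (cvar - S) * W"
  have at1: "at1 F = 3 * T - T ^ 2 - 1"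
    unfolding F_def
    by (simp add: at1_hom at1_cvar S_def at1_lift V1 flip: V_def)
      (simp add: algebra_simps power2_eq_square)
  have "lift (at1 F) = S + S + S - S ^ 2 - 1"
  proof -
    have "at1 F = T + T + T - T ^ 2 - 1" unfolding at1 by simp
    then show ?thesis by (simp only: lift_hom lift_power S_def)
  qed
  then have G: "lift (at1 F) = 3 * S - S ^ 2 - 1" by simp
  have XS: "fps_X * S ^ 3 = S - 1" using S by algebra
  \<comment> \<open>Multiplied by \<open>S ^ 2\<close>, the equation of \<open>W\<close> contains t
    only in \<open>fps_X * S ^ 3\<close>, which is \<open>S - 1\<close>.\<close>
  have "S ^ 2 * W = (fps_X * S ^ 3) * (S + cvar * W * (1 + W))"
    by (subst W) (simp add: algebra_simps power2_eq_square power3_eq_cube)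
  then have q: "(S - 1) * (S + cvar * W * (1 + W)) - S ^ 2 * W = 0"
    unfolding XS by simp
  \<comment> \<open>The factor \<open>S ^ 3\<close> eliminates t in the same way and leaves a
    polynomial multiple of the equation of \<open>W\<close>.\<close>
  have "S ^ 3 * ((cvar - 1) * (F - 1) - fps_X * (cvar * F * (cvar - 1 + F - lift (at1 F))))
      = S ^ 3 * (cvar - 1) * (F - 1) - (fps_X * S ^ 3) * (cvar * F * (cvar - 1 + F - lift (at1 F)))"
    by (simp add: algebra_simps)
  also have "\<dots> = - ((cvar - S) ^ 2 * ((S - 1) * (S + cvar * W * (1 + W)) - S ^ 2 * W))"
    unfolding XS G unfolding F_def by algebra
  finally have "S ^ 3 * ((cvar - 1) * (F - 1) - fps_X * (cvar * F * (cvar - 1 + F - lift (at1 F)))) = 0"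
    unfolding q by simp
  moreover have "S \<noteq> 0" using S by auto
  ultimately have "catalytic F"
    unfolding catalytic_def by simp
  with at1 show ?thesis by blast
qed

section \<open>Coefficients of the algebraic solution\<close>

lemma ternary_coeff:
  fixes T :: "real fps"
  assumes T: "T = 1 + fps_X * T ^ 3"
  shows "(3 * T - T ^ 2) $ m = 2 * fact (3 * m) / (fact (m + 1) * fact (2 * m + 1))"
proof -
  \<comment> \<open>The Euler operator multiplies coefficient \<open>n\<close> by \<open>n\<close>,
    so a linear differential equation becomes a recurrence.\<close>
  define \<theta> where "\<theta> f = fps_X * fps_deriv f" for f :: "real fps"
  have nth_\<theta>: "\<theta> f $ n = real n * f $ n" for f n
    by (cases n) (simp_all add: \<theta>_def)
  define U where "U = \<theta> T"
  define G where "G = 3 * T - T ^ 2"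
  have prod: "\<theta> (f * g) = \<theta> f * g + f * \<theta> g" for f g
    by (simp add: \<theta>_def algebra_simps)
  have lin: "\<theta> (f + g) = \<theta> f + \<theta> g" "\<theta> (f - g) = \<theta> f - \<theta> g" for f g
    by (simp_all add: \<theta>_def algebra_simps)
  have "U = fps_X * T ^ 3 + fps_X * (3 * T ^ 2 * U)"
    unfolding U_def \<theta>_def
    by (subst T) (simp add: algebra_simps power2_eq_square power3_eq_cube)
  \<comment> \<open>Multiply by \<open>T\<close> and replace \<open>fps_X * T ^ 3\<close> by
    \<open>T - 1\<close>.\<close>
  then have U: "U * (3 - 2 * T) = T * (T - 1)"
    using T by algebra
  have G1: "\<theta> G = T ^ 2 - T"
  proof -
    have "\<theta> G = U + U + U - (U * T + T * U)"
      unfolding G_def power2_eq_square U_def by (simp add: \<theta>_def algebra_simps)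
    then show ?thesis using U by algebra
  qed
  have G2: "\<theta> (\<theta> G) = 2 * T * U - U"
    unfolding G1 power2_eq_square by (simp add: lin prod U_def)
  have T0: "T $ 0 = 1" by (subst T) simp
  have D: "3 - 2 * T \<noteq> 0"
  proof
    assume "3 - 2 * T = 0"
    then have "(3 - 2 * T) $ 0 = 0" by simp
    then show False using T0 by (simp add: fps_mult_nth_0 fps_numeral_nth)
  qed
  \<comment> \<open>The differential equation encodes the ratio of consecutive terms of the claimed formula.\<close>
  have "(3 - 2 * T) * (4 * (2 * T * U - U) + 6 * (T ^ 2 - T) + 2 * G - 4)
      = (3 - 2 * T) * (fps_X * (27 * (2 * T * U - U) + 27 * (T ^ 2 - T) + 6 * G))"
    using U T unfolding G_def by algebra
  then have ode: "4 * \<theta> (\<theta> G) + 6 * \<theta> G + 2 * G - 4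
      = fps_X * (27 * \<theta> (\<theta> G) + 27 * \<theta> G + 6 * G)"
    using D unfolding G2 unfolding G1 by simp
  \<comment> \<open>The constant 4 only enters coefficient 0. With \<open>m = k + 1\<close>,
    \<open>4 m^2 + 6 m + 2 = 2 (m + 1) (2 m + 1)\<close>, and
    \<open>27 k^2 + 27 k + 6 = 3 (3 k + 1) (3 k + 2)\<close>.\<close>
  have rec: "2 * (real k + 2) * (2 * real k + 3) * G $ Suc k
      = 3 * (3 * real k + 1) * (3 * real k + 2) * G $ k" for k
    using arg_cong[OF ode, of "\<lambda>f. f $ Suc k"]
    by (simp add: nth_\<theta> fps_numeral_nth numeral_fps_const algebra_simps)
  have solve: "g = b / a * h" if "a * g = b * h" "a \<noteq> 0" for a b g h :: real
    using that by (simp add: field_simps)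
  \<comment> \<open>Used with \<open>c = k + 1\<close>, which supplies the missing factors
    \<open>3 k + 3\<close> and \<open>2 k + 2\<close> of the factorials.\<close>
  have cancel: "3 * p * q / (2 * r * s) * (2 * f / (g * h))
      = 2 * (3 * c * q * p * f) / ((r * g) * (s * (2 * c) * h))" if "c \<noteq> 0"
    for p q r s f g h c :: real
    using that by (simp add: divide_simps)
  have "G $ m = 2 * fact (3 * m) / (fact (m + 1) * fact (2 * m + 1))"
  proof (induction m)
    case 0
    then show ?case using T0 by (simp add: G_def numeral_fps_const power2_eq_square)
  next
    case (Suc k)
    have "G $ Suc k = 3 * (3 * real k + 1) * (3 * real k + 2) / (2 * (real k + 2) * (2 * real k + 3)) * G $ k"
      by (rule solve[OF rec[of k]]) (simp add: add_nonneg_eq_0_iff)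
    also have "\<dots> = 3 * (3 * real k + 1) * (3 * real k + 2) / (2 * (real k + 2) * (2 * real k + 3)) *
        (2 * fact (3 * k) / (fact (k + 1) * fact (2 * k + 1)))"
      by (simp only: Suc)
    also have "\<dots> = 2 * (3 * (real k + 1) * (3 * real k + 2) * (3 * real k + 1) * fact (3 * k)) /
        (((real k + 2) * fact (k + 1)) * ((2 * real k + 3) * (2 * (real k + 1)) * fact (2 * k + 1)))"
      by (rule cancel) linarith
    also have "3 * (real k + 1) * (3 * real k + 2) * (3 * real k + 1) * fact (3 * k) = fact (3 * Suc k)"
    proof -
      have "3 * Suc k = Suc (Suc (Suc (3 * k)))" by simp
      then show ?thesis by (simp only: fact_Suc of_nat_mult of_nat_Suc) (simp add: algebra_simps)
    qed
    also have "(2 * real k + 3) * (2 * (real k + 1)) * fact (2 * k + 1) = fact (2 * Suc k + 1)"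
    proof -
      have "2 * Suc k + 1 = Suc (Suc (2 * k + 1))" by simp
      then show ?thesis by (simp only: fact_Suc of_nat_mult of_nat_Suc) (simp add: algebra_simps)
    qed
    also have "(real k + 2) * fact (k + 1) = fact (Suc k + 1)"
      by (simp add: algebra_simps)
    finally show ?case .
  qed
  then show ?thesis by (simp add: G_def)
qed

text \<open>\<open>interval_poly_Suc\<close> and \<open>split_poly_diff\<close> become equations of
  series, from which \<open>P\<close> is eliminated.\<close>

lemma catalytic_interval_poly: "catalytic (Abs_fps interval_poly)"
proof -
  define F where "F = Abs_fps interval_poly"
  define P where "P = Abs_fps split_poly"
  have F: "F - 1 = fps_X * (cvar * P * F)"
  proof (rule fps_ext)
    fix n
    show "(F - 1) $ n = (fps_X * (cvar * P * F)) $ n"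
    proof (cases n)
      case 0
      then show ?thesis by (simp add: F_def interval_poly_0)
    next
      case (Suc m)
      then show ?thesis
        by (simp add: F_def P_def cvar_def interval_poly_Suc fps_mult_nth[of _ "Abs_fps interval_poly"]
            atLeast0AtMost)
    qed
  qed
  \<comment> \<open>At \<open>n = 0\<close>, where \<open>split_poly_diff\<close> does not apply,
    the summand \<open>cvar - 1\<close> accounts for the constant term 1 of
    \<open>P\<close>.\<close>
  have P: "(cvar - 1) * P = cvar - 1 + F - lift (at1 F)"
  proof (rule fps_ext)
    fix n
    have "cvar - 1 = fps_const (monom 1 1 - 1)"
      by (simp add: cvar_def flip: fps_const_sub)
    moreover have "- 1 = [:- 1 :: real:]" by (simp add: one_pCons)
    ultimately show "((cvar - 1) * P) $ n = (cvar - 1 + F - lift (at1 F)) $ n"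
      using split_poly_diff[of n]
      by (cases "n = 0") (simp_all add: P_def F_def lift_nth at1_nth interval_poly_0 split_poly_0)
  qed
  have "(cvar - 1) * (F - 1) = fps_X * (cvar * F * ((cvar - 1) * P))"
    unfolding F by (simp add: mult_ac)
  then show ?thesis
    unfolding P catalytic_def F_def .
qed

lemma card_intervals_Suc:
  "real (card (intervals (Suc n))) = 2 * fact (3 * n + 3) / (fact (n + 2) * fact (2 * n + 3))"
proof -
  obtain T :: "real fps" where T: "T = 1 + fps_X * T ^ 3" using ternary_exists by blast
  then obtain F where F: "catalytic F" "at1 F = 3 * T - T ^ 2 - 1"
    using catalytic_solution by blast
  have "F = Abs_fps interval_poly"
    using F(1) catalytic_interval_poly by (rule catalytic_unique)
  then have "real (card (intervals (Suc n))) = at1 F $ Suc n"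
    by (simp add: card_intervals at1_nth)
  \<comment> \<open>The summand -1 of \<open>at1 F\<close> only affects coefficient 0.\<close>
  also have "\<dots> = (3 * T - T ^ 2) $ Suc n" by (simp add: F(2))
  also have "\<dots> = 2 * fact (3 * Suc n) / (fact (Suc n + 1) * fact (2 * Suc n + 1))"
    by (rule ternary_coeff[OF T])
  also have "3 * Suc n = 3 * n + 3" by simp
  also have "Suc n + 1 = n + 2" by simp
  also have "2 * Suc n + 1 = 2 * n + 3" by simp
  finally show ?thesis .
qed

theorem theorem1:
  fixes n :: nat
  shows "real (\<Sum>v \<in> {v :: grid_path. length v = n}.
            card {(v1, v2). v1 \<in> Tam v \<and> v2 \<in> Tam v \<and> tam_le v v1 v2})
         = 2 * fact (3 * n + 3) / (fact (n + 2) * fact (2 * n + 3))"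
  unfolding sum_card_tam_intervals by (rule card_intervals_Suc)

end
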